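(* Let $P\subseteq\mathbb{R}^n$ be an $n$-simplex and let $(\mathcal{A},\varepsilon)$ be a signed support in $\mathbb{R}^n$ with Gale dual matrix $B$ such that $\mathcal{A}_+\subseteq P$, $\mathcal{A}_-\subseteq P^-$, and $\mathcal{A}\cap\operatorname{int}(P\cup P^-)\neq\emptyset$. Then: (i) for all $c\in\mathbb{R}^{\mathcal{A}}_\varepsilon$ and all singular points $x\in\operatorname{Sing}(f_c)$ the eigenvalues of $\operatorname{Hess}_{f_c}(x)$ are negative; (ii) if $\mathcal{A}$ has codimension $2$, then the complement $\mathbb{R}^2\setminus\Gamma_\varepsilon(A,B)$ of the signed reduced $A$-discriminant consists of at most two connected components.
   Context: A signed support $(\mathcal{A},\varepsilon)$ in $\mathbb{R}^n$ consists of a finite set $\mathcal{A}=\{\alpha_1,\dots,\alpha_{n+k+1}\}\subseteq\mathbb{R}^n$ of (distinct) exponent vectors and a sign distribution $\varepsilon\in\{\pm1\}^{n+k+1}$. Put $\mathcal{A}_+=\{\alpha_i:\varepsilon_i=1\}$, $\mathcal{A}_-=\{\alpha_i:\varepsilon_i=-1\}$ and $\mathbb{R}^{\mathcal{A}}_\varepsilon=\{c\in\mathbb{R}^{n+k+1}:\operatorname{sign}(c)=\varepsilon\}$. For $c\in\mathbb{R}^{\mathcal{A}}_\varepsilon$ let $f_c(x)=\sum_i c_i e^{\alpha_i\cdot x}$ on $\mathbb{R}^n$, and let $\operatorname{Sing}(f_c)$ be the set of $x\in\mathbb{R}^n$ at which $f_c$ and all its first partial derivatives vanish. Let $\nabla_{\mathcal{A},\varepsilon}=\{c\in\mathbb{R}^{\mathcal{A}}_\varepsilon:\operatorname{Sing}(f_c)\ne\emptyset\}$.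 Let $\hat A\in\mathbb{R}^{(n+1)\times(n+k+1)}$ have $i$-th column $(1,\alpha_i)^\top$. The codimension of $\mathcal{A}$ is $\dim\ker(\hat A)$ (equal to $k$ if $\dim\operatorname{Conv}(\mathcal{A})=n$). A Gale dual matrix $B$ of $\mathcal{A}$ is a matrix whose columns form a basis of $\ker(\hat A)$. The signed reduced $A$-discriminant is $\Gamma_\varepsilon(A,B)=\{B^\top\operatorname{Log}|c|:c\in\nabla_{\mathcal{A},\varepsilon}\}$ (coordinate-wise absolute value and natural logarithm); it lies in $\mathbb{R}^2$ when the codimension is $2$. For an $n$-simplex $P\subseteq\mathbb{R}^n$ (convex hull of $n+1$ affinely independent points) with vertices $\mu_0,\dots,\mu_n$, the negative vertex cone at $\mu_k$ is $P^{-,k}=\mu_k+\operatorname{Cone}(\mu_k-\mu_0,\dots,\mu_k-\mu_n)$, where $\operatorname{Cone}$ denotes the set of all nonnegative linear combinations, and $P^-=P^{-,0}\cup\dots\cup P^{-,n}$. *)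

theory Defs
  imports "HOL-Analysis.Analysis"
begin

section \<open>Signed supports and exponential sums\<close>

text \<open>
  A support with \<open>m\<close> points in \<open>\<real>\<^sup>n\<close> is an injective family \<open>\<alpha>\<close> indexed by the finite type
  \<open>'m\<close>, where \<open>m = CARD('m)\<close>; coefficient vectors \<open>c\<close> have type \<open>real ^ 'm\<close>.
\<close>

definition signed_support :: "('m::finite \<Rightarrow> real ^ 'n) \<Rightarrow> ('m \<Rightarrow> real) \<Rightarrow> bool" where
  "signed_support \<alpha> \<epsilon> \<longleftrightarrow> inj \<alpha> \<and> (\<forall>i. \<epsilon> i \<in> {1, -1})"

definition pos_support :: "('m::finite \<Rightarrow> real ^ 'n) \<Rightarrow> ('m \<Rightarrow> real) \<Rightarrow> (real ^ 'n) set" where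
  "pos_support \<alpha> \<epsilon> = \<alpha> ` {i. \<epsilon> i = 1}"

definition neg_support :: "('m::finite \<Rightarrow> real ^ 'n) \<Rightarrow> ('m \<Rightarrow> real) \<Rightarrow> (real ^ 'n) set" where
  "neg_support \<alpha> \<epsilon> = \<alpha> ` {i. \<epsilon> i = -1}"

definition coeff_orthant :: "('m::finite \<Rightarrow> real) \<Rightarrow> (real ^ 'm) set" where
  "coeff_orthant \<epsilon> = {c. \<forall>i. sgn (c $ i) = \<epsilon> i}"

definition exp_sum :: "('m::finite \<Rightarrow> real ^ 'n) \<Rightarrow> real ^ 'm \<Rightarrow> real ^ 'n \<Rightarrow> real" where
  "exp_sum \<alpha> c x = (\<Sum>i\<in>UNIV. c $ i * exp (\<alpha> i \<bullet> x))"

definition partial_deriv :: "'n \<Rightarrow> (real ^ 'n::finite \<Rightarrow> real) \<Rightarrow> real ^ 'n \<Rightarrow> real" where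
  "partial_deriv j f x = deriv (\<lambda>t. f (x + t *\<^sub>R axis j 1)) 0"

definition hessian :: "(real ^ 'n::finite \<Rightarrow> real) \<Rightarrow> real ^ 'n \<Rightarrow> real ^ 'n ^ 'n" where
  "hessian f x = (\<chi> i j. partial_deriv i (partial_deriv j f) x)"

definition sing :: "(real ^ 'n::finite \<Rightarrow> real) \<Rightarrow> (real ^ 'n) set" where
  "sing f = {x. f x = 0 \<and> (\<forall>j. partial_deriv j f x = 0)}"

text \<open>
  Only real eigenvalues are considered; the notion is applied to Hessians of smooth functions,
  which are symmetric and hence have no others.
\<close>

definition eigenvalue :: "real ^ 'n ^ 'n::finite \<Rightarrow> real \<Rightarrow> bool" where
  "eigenvalue M l \<longleftrightarrow> (\<exists>v. v \<noteq> 0 \<and> M *v v = l *\<^sub>R v)"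


section \<open>Gale duality and the signed reduced discriminant\<close>

definition signed_discriminant ::
    "('m::finite \<Rightarrow> real ^ 'n) \<Rightarrow> ('m \<Rightarrow> real) \<Rightarrow> (real ^ 'm) set" where
  "signed_discriminant \<alpha> \<epsilon> = {c \<in> coeff_orthant \<epsilon>. sing (exp_sum \<alpha> c) \<noteq> {}}"

text \<open>
  The rows of the \<open>(n+1) \<times> m\<close> matrix are indexed by \<open>'n option\<close>, where \<open>None\<close> stands for the
  row of ones.
\<close>

definition hat_matrix :: "('m::finite \<Rightarrow> real ^ 'n::finite) \<Rightarrow> real ^ 'm ^ ('n option)" where
  "hat_matrix \<alpha> = (\<chi> r i. case r of None \<Rightarrow> 1 | Some j \<Rightarrow> \<alpha> i $ j)"

definition hat_kernel :: "('m::finite \<Rightarrow> real ^ 'n::finite) \<Rightarrow> (real ^ 'm) set" where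
  "hat_kernel \<alpha> = {v. hat_matrix \<alpha> *v v = 0}"

definition codimension :: "('m::finite \<Rightarrow> real ^ 'n::finite) \<Rightarrow> nat" where
  "codimension \<alpha> = dim (hat_kernel \<alpha>)"

text \<open>Injectivity is needed because \<^const>\<open>columns\<close> is a set and forgets repeated columns.\<close>

definition gale_dual :: "('m::finite \<Rightarrow> real ^ 'n::finite) \<Rightarrow> real ^ 'd ^ 'm \<Rightarrow> bool" where
  "gale_dual \<alpha> B \<longleftrightarrow>
     inj (\<lambda>j. column j B) \<and> independent (columns B) \<and> span (columns B) = hat_kernel \<alpha>"

definition signed_reduced_discriminant ::
    "('m::finite \<Rightarrow> real ^ 'n) \<Rightarrow> ('m \<Rightarrow> real) \<Rightarrow> real ^ 'd ^ 'm \<Rightarrow> (real ^ 'd) set" where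
  "signed_reduced_discriminant \<alpha> \<epsilon> B =
     {transpose B *v (\<chi> i. ln \<bar>c $ i\<bar>) | c. c \<in> signed_discriminant \<alpha> \<epsilon>}"


section \<open>Negative vertex cones\<close>

text \<open>
  \<open>V\<close> is the vertex set of a simplex \<open>convex hull V\<close>. The generator \<open>\<mu> - \<mu> = 0\<close> contributes
  nothing to the cone and is kept for uniformity.
\<close>

definition nonneg_cone :: "'a::real_vector set \<Rightarrow> 'a set" where
  "nonneg_cone S = {\<Sum>v\<in>S. t v *\<^sub>R v | t. \<forall>v\<in>S. 0 \<le> t v}"

definition neg_vertex_cone :: "'a::real_vector set \<Rightarrow> 'a \<Rightarrow> 'a set" where
  "neg_vertex_cone V \<mu> = (\<lambda>y. \<mu> + y) ` nonneg_cone ((\<lambda>\<nu>. \<mu> - \<nu>) ` V)"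

definition neg_vertex_cones :: "'a::real_vector set \<Rightarrow> 'a set" where
  "neg_vertex_cones V = (\<Union>\<mu>\<in>V. neg_vertex_cone V \<mu>)"

end

theory Submission
  imports Defs
begin

text \<open>
  A point \<open>x\<close> is singular for \<open>f\<^sub>c\<close> exactly if the vector \<open>w\<close> with entries \<open>w\<^sub>i = c\<^sub>i exp (\<alpha>\<^sub>i \<bullet> x)\<close>, which has
  the signs of \<open>c\<close>, lies in the kernel of the hat matrix, that is, if \<open>w\<close> annihilates all affine functions
  of the exponents. The Hessian of \<open>f\<^sub>c\<close> at \<open>x\<close> is the quadratic form \<open>v \<mapsto> \<Sum>i. w\<^sub>i (v \<bullet> \<alpha>\<^sub>i)\<^sup>2\<close>. Both claims
  follow from the negative definiteness of this form, \<open>kernel_form_negative_definite\<close>.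

  For the definiteness, compare the convex function \<open>h = (v \<bullet> _)\<^sup>2\<close> with the affine function \<open>h'\<close>
  that agrees with it on the vertices of the simplex. By Jensen's inequality \<open>h \<le> h'\<close> on the
  simplex, which contains the positive exponents. In a negative vertex cone the inequality is reversed,
  because the apex is a convex combination of the point and the other vertices. Therefore every term of
  \<open>\<Sum>i. w\<^sub>i (h - h') (\<alpha>\<^sub>i)\<close> is nonpositive, while \<open>w\<close> annihilates \<open>h'\<close>. For \<open>v \<noteq> 0\<close> an
  exponent with no vanishing barycentric coordinate makes its term strictly negative, and the
  hypothesis on interior points provides such an exponent, except that on the line all
  exponents may be vertices, and then the kernel is trivial.

  In codimension two \<open>Horn_Kapranov_parametrization\<close> describes the discriminant as the image of
  an open convex cone in the plane, possibly empty, under a map \<open>\<Phi>\<close> that is constant on rays. So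
  it is a curve whose parameter is the direction of a vector \<open>y\<close>. The velocity of this curve
  is perpendicular to \<open>y\<close>, and it vanishes nowhere: a zero
  would give, by duality between the kernel and the row space, an isotropic vector of the
  quadratic form above. Hence the tangent turns monotonically by less than a half-turn,
  and in suitable coordinates the curve is the graph of a strictly convex function over an open
  interval. The points above such a graph form one connected set, and all other points off the
  graph form another one, joined through a half-plane below a tangent
  (\<open>complement_of_turning_curve\<close>).
\<close>

section \<open>Barycentric coordinates and the negative vertex cones\<close>

definition barycentric :: "'a::real_vector set \<Rightarrow> ('a \<Rightarrow> real) \<Rightarrow> 'a \<Rightarrow> bool" where
  "barycentric V u x \<longleftrightarrow> sum u V = 1 \<and> (\<Sum>v\<in>V. u v *\<^sub>R v) = x"

lemma affine_independent_eq_coeffs: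
  fixes V :: "'a::euclidean_space set"
  assumes "\<not> affine_dependent V" "sum u V = sum u' V"
    and "(\<Sum>v\<in>V. u v *\<^sub>R v) = (\<Sum>v\<in>V. u' v *\<^sub>R v)" and "v \<in> V"
  shows "u v = u' v"
proof (rule ccontr)
  assume "u v \<noteq> u' v"
  moreover have "sum (\<lambda>v. u v - u' v) V = 0" "(\<Sum>v\<in>V. (u v - u' v) *\<^sub>R v) = 0"
    using assms by (simp_all add: sum_subtractf scaleR_diff_left)
  moreover have "finite V"
    by (rule aff_independent_finite[OF assms(1)])
  ultimately have "affine_dependent V"
    unfolding affine_dependent_explicit_finite[OF \<open>finite V\<close>]
    using \<open>v \<in> V\<close> by (intro exI[of _ "\<lambda>v. u v - u' v"]) auto
  with assms(1) show False by blast
qed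

lemma barycentric_unique:
  fixes V :: "'a::euclidean_space set"
  assumes "\<not> affine_dependent V" "barycentric V u x" "barycentric V u' x" "v \<in> V"
  shows "u v = u' v"
  using affine_independent_eq_coeffs[of V u u' v] assms by (auto simp: barycentric_def)

lemma barycentric_exists:
  fixes V :: "'a::euclidean_space set"
  assumes "\<not> affine_dependent V" "card V = DIM('a) + 1"
  shows "\<exists>u. barycentric V u x"
proof -
  have "x \<in> affine hull V"
    using affine_independent_span_eq[of V] assms by simp
  then show ?thesis
    unfolding affine_hull_finite[OF aff_independent_finite[OF assms(1)]] barycentric_def by blast
qed

lemma convex_hull_barycentric:
  assumes "finite V"
  shows "x \<in> convex hull V \<longleftrightarrow> (\<exists>u. barycentric V u x \<and> (\<forall>v\<in>V. 0 \<le> u v))"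
  unfolding convex_hull_finite[OF assms] barycentric_def by blast

text \<open>
  Together with \<open>convex_hull_barycentric\<close>, this describes the two regions by sign patterns:
  in the simplex all coordinates are nonnegative, in the cone at \<open>\<mu>\<close> all but that of \<open>\<mu>\<close> are
  nonpositive. As the coordinates sum to one, the coordinate of \<open>\<mu>\<close> is then at least one.
\<close>
lemma neg_vertex_cone_barycentric:
  fixes V :: "'a::real_vector set"
  assumes "finite V" "\<mu> \<in> V" "x \<in> neg_vertex_cone V \<mu>"
  shows "\<exists>u. barycentric V u x \<and> (\<forall>v\<in>V - {\<mu>}. u v \<le> 0)"
proof -
  obtain t where t: "\<And>v. v \<in> V \<Longrightarrow> 0 \<le> t (\<mu> - v)"
    and x: "x = \<mu> + (\<Sum>y\<in>(\<lambda>\<nu>. \<mu> - \<nu>) ` V. t y *\<^sub>R y)"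
    using assms(3) unfolding neg_vertex_cone_def nonneg_cone_def by auto
  \<comment> \<open>Expanding \<open>\<mu> + (\<Sum>v\<in>V. s v *\<^sub>R (\<mu> - v))\<close> moves the total weight of \<open>s\<close> to \<open>\<mu>\<close>.\<close>
  define s where "s = (\<lambda>v. t (\<mu> - v))"
  have x': "x = \<mu> + (\<Sum>v\<in>V. s v *\<^sub>R (\<mu> - v))"
    unfolding x s_def by (subst sum.reindex) (auto simp: inj_on_def)
  let ?u = "\<lambda>v. (if v = \<mu> then 1 + sum s V else 0) - s v"
  have "sum ?u V = 1"
    using assms by (simp add: sum_subtractf)
  moreover have "(\<Sum>v\<in>V. ?u v *\<^sub>R v) = x"
    using assms
    by (simp add: x' scaleR_diff_left scaleR_diff_right sum_subtractf
        if_distrib[of "\<lambda>c. c *\<^sub>R _"] scaleR_add_left flip: scaleR_sum_left cong: if_cong)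
  ultimately show ?thesis
    using t by (intro exI[of _ ?u]) (auto simp: barycentric_def s_def)
qed

text \<open>
  The parallel axis identity of statistics for a signed measure of total mass one. Its two choices
  of \<open>c\<close>, the mean and the value at a vertex, give Jensen's inequality for squares inside the
  simplex and the reversed inequality beyond a vertex.
\<close>
lemma sum_squared_deviations:
  fixes u g :: "'a \<Rightarrow> real"
  assumes "sum u V = 1"
  shows "(\<Sum>v\<in>V. u v * (g v - c)\<^sup>2)
       = ((\<Sum>v\<in>V. u v * (g v)\<^sup>2) - (\<Sum>v\<in>V. u v * g v)\<^sup>2) + ((\<Sum>v\<in>V. u v * g v) - c)\<^sup>2"
proof -
  have "(\<Sum>v\<in>V. u v * (g v - c)\<^sup>2)
      = (\<Sum>v\<in>V. u v * (g v)\<^sup>2 - 2 * c * (u v * g v) + c\<^sup>2 * u v)"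
    by (rule sum.cong) (auto simp: power2_eq_square algebra_simps)
  also have "\<dots> = (\<Sum>v\<in>V. u v * (g v)\<^sup>2) - 2 * c * (\<Sum>v\<in>V. u v * g v) + c\<^sup>2"
    using assms by (simp add: sum.distrib sum_subtractf flip: sum_distrib_left)
  finally show ?thesis
    by (simp add: power2_eq_square algebra_simps)
qed

lemma variance_convex_combination:
  fixes u g :: "'a \<Rightarrow> real"
  assumes "finite V" "sum u V = 1" "\<And>v. v \<in> V \<Longrightarrow> 0 \<le> u v"
  defines "D \<equiv> (\<Sum>v\<in>V. u v * (g v)\<^sup>2) - (\<Sum>v\<in>V. u v * g v)\<^sup>2"
  shows "0 \<le> D" and "D = 0 \<Longrightarrow> \<exists>c. \<forall>v\<in>V. u v \<noteq> 0 \<longrightarrow> g v = c"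
proof -
  let ?G = "\<Sum>v\<in>V. u v * g v"
  have D: "D = (\<Sum>v\<in>V. u v * (g v - ?G)\<^sup>2)"
    unfolding D_def sum_squared_deviations[OF assms(2)] by simp
  show "0 \<le> D"
    unfolding D by (intro sum_nonneg) (simp add: assms(3))
  assume "D = 0"
  then have "\<forall>v\<in>V. u v * (g v - ?G)\<^sup>2 = 0"
    unfolding D using assms by (subst (asm) sum_nonneg_eq_0_iff) auto
  then show "\<exists>c. \<forall>v\<in>V. u v \<noteq> 0 \<longrightarrow> g v = c"
    by (intro exI[of _ ?G]) auto
qed

text \<open>
  The vertex \<open>\<mu>\<close> is a convex combination of the point with coordinates \<open>u\<close> and the other
  vertices, so Jensen's inequality centred at \<open>\<mu>\<close> bounds the difference from above.
\<close>
lemma variance_beyond_vertex: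
  fixes u g :: "'a \<Rightarrow> real"
  assumes "finite V" "\<mu> \<in> V" "sum u V = 1" "\<And>v. v \<in> V - {\<mu>} \<Longrightarrow> u v \<le> 0"
  defines "D \<equiv> (\<Sum>v\<in>V. u v * (g v)\<^sup>2) - (\<Sum>v\<in>V. u v * g v)\<^sup>2"
  shows "D \<le> 0" and "D = 0 \<Longrightarrow> \<exists>c. \<forall>v\<in>V. u v \<noteq> 0 \<longrightarrow> g v = c"
proof -
  let ?G = "\<Sum>v\<in>V. u v * g v"
  have D: "- D = (\<Sum>v\<in>V. - u v * (g v - g \<mu>)\<^sup>2) + (?G - g \<mu>)\<^sup>2"
    using sum_squared_deviations[OF assms(3), of g "g \<mu>"] by (simp add: D_def sum_negf)
  have nonneg: "0 \<le> - u v * (g v - g \<mu>)\<^sup>2" if "v \<in> V" for v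
    using assms(4) that by (cases "v = \<mu>") (auto intro: mult_nonpos_nonneg)
  then have sum_nonneg: "0 \<le> (\<Sum>v\<in>V. - u v * (g v - g \<mu>)\<^sup>2)"
    by (rule sum_nonneg)
  with D show "D \<le> 0"
    using zero_le_power2[of "?G - g \<mu>"] by linarith
  assume "D = 0"
  with D sum_nonneg have "(\<Sum>v\<in>V. - u v * (g v - g \<mu>)\<^sup>2) = 0"
    using zero_le_power2[of "?G - g \<mu>"] by linarith
  then have "\<forall>v\<in>V. - u v * (g v - g \<mu>)\<^sup>2 = 0"
    using assms(1) nonneg by (subst (asm) sum_nonneg_eq_0_iff) auto
  then show "\<exists>c. \<forall>v\<in>V. u v \<noteq> 0 \<longrightarrow> g v = c"
    by (intro exI[of _ "g \<mu>"]) auto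
qed

text \<open>
  A point with two positive coordinates and a negative one lies outside the union. If some coordinate
  of a point of the union is zero and there are at least two further vertices, a small change of the
  coordinates produces this pattern, so the point is not interior. With only two vertices, as for
  a segment on the line, the pattern does not exist and the union is everything.
\<close>
lemma interior_barycentric_nonzero:
  fixes V :: "'a::euclidean_space set"
  assumes indep: "\<not> affine_dependent V" and card: "card V \<ge> 3"
    and x: "x \<in> interior (convex hull V \<union> neg_vertex_cones V)"
    and u: "barycentric V u x" and w: "w \<in> V"
  shows "u w \<noteq> 0"
proof
  assume "u w = 0"
  have fin: "finite V" by (rule aff_independent_finite[OF indep])
  have dich: "(\<forall>v\<in>V. 0 \<le> u' v) \<or> (\<exists>\<mu>\<in>V. \<forall>v\<in>V - {\<mu>}. u' v \<le> 0)"
    if "barycentric V u' y" "y \<in> convex hull V \<union> neg_vertex_cones V" for u' y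
  proof -
    from that(2) consider "y \<in> convex hull V" | \<mu> where "\<mu> \<in> V" "y \<in> neg_vertex_cone V \<mu>"
      by (auto simp: neg_vertex_cones_def)
    then show ?thesis
    proof cases
      case 1
      then show ?thesis
        using convex_hull_barycentric[OF fin] barycentric_unique[OF indep that(1)] by metis
    next
      case 2
      then show ?thesis
        using neg_vertex_cone_barycentric[OF fin] barycentric_unique[OF indep that(1)]
        by (metis DiffD1)
    qed
  qed
  have perturb: "\<exists>\<delta>>0. (\<forall>v\<in>V. 0 \<le> u v + \<delta> * d v) \<or> (\<exists>\<mu>\<in>V. \<forall>v\<in>V - {\<mu>}. u v + \<delta> * d v \<le> 0)"
    if "sum d V = 0" for d
  proof -
    let ?x = "\<lambda>\<delta>. x + \<delta> *\<^sub>R (\<Sum>v\<in>V. d v *\<^sub>R v)"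
    have "((\<lambda>\<delta>. ?x \<delta>) \<longlongrightarrow> x + 0 *\<^sub>R (\<Sum>v\<in>V. d v *\<^sub>R v)) (at_right 0)"
      by (intro tendsto_intros)
    then have "\<forall>\<^sub>F \<delta> in at_right 0. ?x \<delta> \<in> interior (convex hull V \<union> neg_vertex_cones V)"
      using x by (intro topological_tendstoD) auto
    then have "\<forall>\<^sub>F \<delta> in at_right 0. ?x \<delta> \<in> convex hull V \<union> neg_vertex_cones V \<and> \<delta> > 0"
      using eventually_at_right_less[of "0::real"]
      by eventually_elim (use interior_subset in blast)
    then obtain \<delta> where "?x \<delta> \<in> convex hull V \<union> neg_vertex_cones V" "\<delta> > 0"
      using eventually_happens'[OF trivial_limit_at_right_real] by blast
    moreover have "barycentric V (\<lambda>v. u v + \<delta> * d v) (?x \<delta>)"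
      using u that
      by (simp add: barycentric_def sum.distrib scaleR_add_left flip: sum_distrib_left scaleR_scaleR
          scaleR_sum_right)
    ultimately show ?thesis
      using dich by blast
  qed
  have "card (V - {w}) \<ge> 2" using card w by simp
  then obtain a b where ab: "a \<in> V" "b \<in> V" "a \<noteq> b" "a \<noteq> w" "b \<noteq> w"
    by (metis DiffE card_le_Suc0_iff_eq fin finite_Diff insertI1 not_less_eq_eq numeral_2_eq_2)
  from u have "x \<in> convex hull V \<union> neg_vertex_cones V"
    using x interior_subset by blast
  from dich[OF u this] show False
  proof
    assume nonneg: "\<forall>v\<in>V. 0 \<le> u v"
    \<comment> \<open>Push \<open>w\<close> below zero and the two other vertices above it.\<close>
    define d where "d = (\<lambda>v. (if v = a then 1 else 0) + (if v = b then 1 else 0)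
                        - (if v = w then 2 else (0::real)))"
    have "sum d V = 0"
      using ab w fin by (simp add: d_def sum.distrib sum_subtractf)
    from perturb[OF this] obtain \<delta> where \<delta>: "\<delta> > 0"
      "(\<forall>v\<in>V. 0 \<le> u v + \<delta> * d v) \<or> (\<exists>\<mu>\<in>V. \<forall>v\<in>V - {\<mu>}. u v + \<delta> * d v \<le> 0)" by blast
    have "u w + \<delta> * d w < 0" "u a + \<delta> * d a > 0" "u b + \<delta> * d b > 0"
      using \<open>u w = 0\<close> nonneg ab \<delta>(1) by (auto simp: d_def intro: add_nonneg_pos)
    with \<delta>(2) ab w show False
      by (metis DiffI empty_iff insert_iff linorder_not_le)
  next
    assume "\<exists>\<mu>\<in>V. \<forall>v\<in>V - {\<mu>}. u v \<le> 0"
    then obtain \<mu> where \<mu>: "\<mu> \<in> V" "\<And>v. v \<in> V \<Longrightarrow> v \<noteq> \<mu> \<Longrightarrow> u v \<le> 0" by auto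
    have "1 = u \<mu> + sum u (V - {\<mu>})"
      using u fin \<mu>(1) by (simp add: barycentric_def sum.remove)
    moreover have "sum u (V - {\<mu>}) \<le> 0"
      using \<mu>(2) by (intro sum_nonpos) auto
    ultimately have "u \<mu> \<ge> 1" by linarith
    then have "w \<noteq> \<mu>" using \<open>u w = 0\<close> by auto
    obtain c where c: "c \<in> V" "c \<noteq> w" "c \<noteq> \<mu>"
      using ab by metis
    \<comment> \<open>Make \<open>w\<close> positive and \<open>c\<close> negative; \<open>\<mu>\<close> is positive already.\<close>
    define d where "d = (\<lambda>v. (if v = w then 1 else 0) - (if v = c then 1 else (0::real)))"
    have "sum d V = 0"
      using c w fin by (simp add: d_def sum_subtractf)
    from perturb[OF this] obtain \<delta> where \<delta>: "\<delta> > 0"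
      "(\<forall>v\<in>V. 0 \<le> u v + \<delta> * d v) \<or> (\<exists>\<mu>\<in>V. \<forall>v\<in>V - {\<mu>}. u v + \<delta> * d v \<le> 0)" by blast
    have "u w + \<delta> * d w > 0" "u c + \<delta> * d c < 0" "u \<mu> + \<delta> * d \<mu> > 0"
      using \<open>u w = 0\<close> \<open>u \<mu> \<ge> 1\<close> \<open>w \<noteq> \<mu>\<close> c \<mu> \<delta>(1) by (auto simp: d_def intro: le_less_trans)
    with \<delta>(2) c w \<mu>(1) \<open>w \<noteq> \<mu>\<close> show False
      by (metis DiffI empty_iff insert_iff linorder_not_le)
  qed
qed

section \<open>The quadratic form of a kernel vector\<close>

lemma hat_kernel_iff:
  "w \<in> hat_kernel \<alpha> \<longleftrightarrow> (\<Sum>i\<in>UNIV. w $ i) = 0 \<and> (\<Sum>i\<in>UNIV. w $ i *\<^sub>R \<alpha> i) = 0"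
proof -
  have "w \<in> hat_kernel \<alpha> \<longleftrightarrow> (\<forall>r. (hat_matrix \<alpha> *v w) $ r = 0)"
    by (simp add: hat_kernel_def vec_eq_iff)
  also have "\<dots> \<longleftrightarrow> (hat_matrix \<alpha> *v w) $ None = 0 \<and> (\<forall>j. (hat_matrix \<alpha> *v w) $ Some j = 0)"
    by (metis option.exhaust)
  finally show ?thesis
    by (simp add: hat_matrix_def matrix_vector_mult_def vec_eq_iff mult.commute)
qed

lemma hat_kernel_affine:
  assumes "w \<in> hat_kernel \<alpha>"
  shows "(\<Sum>i\<in>UNIV. w $ i * (x \<bullet> \<alpha> i + c)) = 0"
proof -
  have "(\<Sum>i\<in>UNIV. w $ i * (x \<bullet> \<alpha> i + c)) = x \<bullet> (\<Sum>i\<in>UNIV. w $ i *\<^sub>R \<alpha> i) + c * (\<Sum>i\<in>UNIV. w $ i)"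
    by (simp add: inner_sum_right sum.distrib sum_distrib_left algebra_simps)
  with assms show ?thesis
    by (simp add: hat_kernel_iff)
qed

text \<open>
  The orthogonal complement of a null space is the row space, and the row space of the
  hat matrix consists of the affine functions evaluated at the exponents.
\<close>
lemma annihilator_hat_kernel:
  fixes \<alpha> :: "'m::finite \<Rightarrow> real ^ 'n::finite" and z :: "real ^ 'm"
  assumes "\<And>y. y \<in> hat_kernel \<alpha> \<Longrightarrow> y \<bullet> z = 0"
  shows "\<exists>c x. \<forall>i. z $ i = x \<bullet> \<alpha> i + c"
proof -
  let ?A = "hat_matrix \<alpha>"
  have "hat_kernel \<alpha> = (range (\<lambda>y. transpose ?A *v y))\<^sup>\<bottom>"
    using ker_orthogonal_comp_adjoint[OF matrix_vector_mul_linear, of ?A]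
    by (auto simp: hat_kernel_def adjoint_matrix vimage_def)
  moreover have "subspace (range (\<lambda>y. transpose ?A *v y))"
    by (intro linear_subspace_image matrix_vector_mul_linear subspace_UNIV)
  ultimately have "(hat_kernel \<alpha>)\<^sup>\<bottom> = range (\<lambda>y. transpose ?A *v y)"
    by (simp add: orthogonal_comp_self)
  moreover have "z \<in> (hat_kernel \<alpha>)\<^sup>\<bottom>"
    using assms by (simp add: orthogonal_comp_def orthogonal_def)
  ultimately obtain y where y: "z = transpose ?A *v y" by auto
  have "z $ i = (\<chi> j. y $ Some j) \<bullet> \<alpha> i + y $ None" for i
    by (simp add: y transpose_def hat_matrix_def matrix_vector_mult_def inner_vec_def
        UNIV_option_conv sum.reindex mult.commute)
  then show ?thesis by blast
qed

text \<open>
  For \<open>n \<ge> 2\<close> any exponent in the interior will do. For \<open>n = 1\<close> the union is the whole line, so an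
  interior exponent may be a vertex; but if every exponent were one of the two
  vertices, the exponents would be affinely independent and the kernel could not contain
  a vector without zero entries.
\<close>
lemma simplex_support_interior_point:
  fixes V :: "(real ^ 'n) set" and \<alpha> :: "'m::finite \<Rightarrow> real ^ 'n"
  assumes indep: "\<not> affine_dependent V" and card: "card V = CARD('n) + 1"
    and supp: "signed_support \<alpha> \<epsilon>"
    and int: "range \<alpha> \<inter> interior (convex hull V \<union> neg_vertex_cones V) \<noteq> {}"
    and w: "w \<in> hat_kernel \<alpha>" "w \<in> coeff_orthant \<epsilon>"
    and L: "\<And>i. barycentric V (L i) (\<alpha> i)"
  shows "\<exists>i. \<forall>v\<in>V. L i v \<noteq> 0"
proof (cases "card V \<ge> 3")
  case True
  from int obtain i where "\<alpha> i \<in> interior (convex hull V \<union> neg_vertex_cones V)" by blast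
  then show ?thesis
    using interior_barycentric_nonzero[OF indep True _ L] by blast
next
  case False
  with card have "card V = 2"
    using zero_less_card_finite[where 'a = 'n] by linarith
  then obtain a b where V: "V = {a, b}" "a \<noteq> b"
    by (auto simp: card_2_iff)
  show ?thesis
  proof (rule ccontr)
    assume "\<nexists>i. \<forall>v\<in>V. L i v \<noteq> 0"
    then have "\<alpha> i \<in> V" for i
    proof -
      have "L i a = 0 \<or> L i b = 0"
        using \<open>\<nexists>i. \<forall>v\<in>V. L i v \<noteq> 0\<close> V by auto
      then show ?thesis
        using L[of i] V by (auto simp: barycentric_def)
    qed
    then have sub: "range \<alpha> \<subseteq> V" by auto
    have inj: "inj \<alpha>" using supp by (simp add: signed_support_def)
    have "\<not> affine_dependent (range \<alpha>)"
      using affine_independent_subset[OF indep sub] .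
    moreover have "sum (\<lambda>y. w $ inv \<alpha> y) (range \<alpha>) = sum (\<lambda>_. 0) (range \<alpha>)"
      "(\<Sum>y\<in>range \<alpha>. (w $ inv \<alpha> y) *\<^sub>R y) = (\<Sum>y\<in>range \<alpha>. 0 *\<^sub>R y)"
      using w(1) inj by (simp_all add: hat_kernel_iff sum.reindex)
    ultimately have "w $ inv \<alpha> (\<alpha> i) = 0" for i
      by (rule affine_independent_eq_coeffs) simp
    then have "w $ i = 0" for i
      using inj by simp
    then show False
      using w(2) supp by (auto simp: coeff_orthant_def signed_support_def)
  qed
qed

text \<open>
  Let \<open>L i\<close> be the barycentric coordinates of \<open>\<alpha> i\<close>, let \<open>g = (\<bullet>) x\<close>, and let \<open>D i\<close> be
  the excess over \<open>(g (\<alpha> i))\<^sup>2\<close> of the affine interpolation of \<open>g\<^sup>2\<close> from the vertices. By Jensen's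
  inequality \<open>D i\<close> has the sign of \<open>w $ i\<close> or is zero. Kernel vectors annihilate
  affine functions, hence \<open>\<Sum>i. w $ i * D i\<close> is minus the form. This sum is nonnegative, and it
  vanishes only if all \<open>D i\<close> do; at an exponent with no zero coordinate this forces \<open>g\<close> to be
  constant on the vertices, hence everywhere, and then \<open>x = 0\<close>.
\<close>
lemma kernel_form_negative_definite:
  fixes V :: "(real ^ 'n) set" and \<alpha> :: "'m::finite \<Rightarrow> real ^ 'n"
  assumes indep: "\<not> affine_dependent V" and card: "card V = CARD('n) + 1"
    and supp: "signed_support \<alpha> \<epsilon>"
    and pos: "pos_support \<alpha> \<epsilon> \<subseteq> convex hull V"
    and neg: "neg_support \<alpha> \<epsilon> \<subseteq> neg_vertex_cones V"
    and int: "range \<alpha> \<inter> interior (convex hull V \<union> neg_vertex_cones V) \<noteq> {}"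
    and w: "w \<in> hat_kernel \<alpha>" "w \<in> coeff_orthant \<epsilon>" and "x \<noteq> 0"
  shows "(\<Sum>i\<in>UNIV. w $ i * (x \<bullet> \<alpha> i)\<^sup>2) < 0"
proof -
  have fin: "finite V" by (rule aff_independent_finite[OF indep])
  have "\<forall>i. \<exists>u. barycentric V u (\<alpha> i)"
    using barycentric_exists[OF indep] card by simp
  then obtain L where L: "\<And>i. barycentric V (L i) (\<alpha> i)" by metis
  have L_inner: "(\<Sum>v\<in>V. L i v * (x \<bullet> v)) = x \<bullet> \<alpha> i" for i
  proof -
    have "\<alpha> i = (\<Sum>v\<in>V. L i v *\<^sub>R v)"
      using L[of i] by (simp add: barycentric_def)
    then show ?thesis by (simp add: inner_sum_right)
  qed
  define D where "D = (\<lambda>i. (\<Sum>v\<in>V. L i v * (x \<bullet> v)\<^sup>2) - (x \<bullet> \<alpha> i)\<^sup>2)"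
  have sgn_w: "sgn (w $ i) = \<epsilon> i" for i
    using w(2) by (simp add: coeff_orthant_def)
  have eps: "\<epsilon> i = 1 \<or> \<epsilon> i = -1" for i
    using supp by (simp add: signed_support_def)
  have D: "0 \<le> w $ i * D i" and D_0: "D i = 0 \<Longrightarrow> \<exists>c. \<forall>v\<in>V. L i v \<noteq> 0 \<longrightarrow> x \<bullet> v = c" for i
  proof -
    have L1: "sum (L i) V = 1" using L[of i] by (simp add: barycentric_def)
    have "0 \<le> w $ i * D i \<and> (D i = 0 \<longrightarrow> (\<exists>c. \<forall>v\<in>V. L i v \<noteq> 0 \<longrightarrow> x \<bullet> v = c))"
      using eps[of i]
    proof
      assume "\<epsilon> i = 1"
      then have "\<alpha> i \<in> convex hull V" using pos by (auto simp: pos_support_def)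
      then have nn: "0 \<le> L i v" if "v \<in> V" for v
        using barycentric_unique[OF indep L] that unfolding convex_hull_barycentric[OF fin] by metis
      have "w $ i > 0" using sgn_w[of i] \<open>\<epsilon> i = 1\<close> by (simp add: sgn_1_pos)
      then show ?thesis
        using variance_convex_combination[OF fin L1 nn, of "\<lambda>v. x \<bullet> v"]
        by (simp add: D_def L_inner)
    next
      assume "\<epsilon> i = -1"
      then obtain \<mu> where \<mu>: "\<mu> \<in> V" "\<alpha> i \<in> neg_vertex_cone V \<mu>"
        using neg by (auto simp: neg_support_def neg_vertex_cones_def)
      then have np: "L i v \<le> 0" if "v \<in> V - {\<mu>}" for v
        using barycentric_unique[OF indep L] neg_vertex_cone_barycentric[OF fin] that
        by (metis DiffD1)
      have "w $ i < 0" using sgn_w[of i] \<open>\<epsilon> i = -1\<close> by (simp add: sgn_1_neg)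
      then show ?thesis
        using variance_beyond_vertex[OF fin \<mu>(1) L1 np, of "\<lambda>v. x \<bullet> v"]
        by (simp add: D_def L_inner mult_nonpos_nonpos)
    qed
    then show "0 \<le> w $ i * D i" "D i = 0 \<Longrightarrow> \<exists>c. \<forall>v\<in>V. L i v \<noteq> 0 \<longrightarrow> x \<bullet> v = c" by auto
  qed
  \<comment> \<open>Each barycentric coordinate is an affine function and is therefore annihilated by \<open>w\<close>.\<close>
  have coord0: "(\<Sum>i\<in>UNIV. w $ i * L i v) = 0" if "v \<in> V" for v
  proof -
    have "(\<Sum>v\<in>V. \<Sum>i\<in>UNIV. w $ i * L i v) = (\<Sum>i\<in>UNIV. w $ i * sum (L i) V)"
      by (subst sum.swap) (simp add: sum_distrib_left)
    also have "\<dots> = 0"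
      using w(1) L by (simp add: barycentric_def hat_kernel_iff)
    finally have 1: "(\<Sum>v\<in>V. \<Sum>i\<in>UNIV. w $ i * L i v) = (\<Sum>v\<in>V. 0)" by simp
    have "(\<Sum>v\<in>V. (\<Sum>i\<in>UNIV. w $ i * L i v) *\<^sub>R v) = (\<Sum>i\<in>UNIV. w $ i *\<^sub>R (\<Sum>v\<in>V. L i v *\<^sub>R v))"
      by (simp add: scaleR_sum_left scaleR_sum_right) (rule sum.swap)
    also have "\<dots> = 0"
      using w(1) L by (simp add: barycentric_def hat_kernel_iff)
    finally have 2: "(\<Sum>v\<in>V. (\<Sum>i\<in>UNIV. w $ i * L i v) *\<^sub>R v) = (\<Sum>v\<in>V. 0 *\<^sub>R v)" by simp
    show ?thesis
      using affine_independent_eq_coeffs[OF indep 1 2 that] .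
  qed
  have "(\<Sum>i\<in>UNIV. w $ i * (\<Sum>v\<in>V. L i v * (x \<bullet> v)\<^sup>2))
      = (\<Sum>v\<in>V. (\<Sum>i\<in>UNIV. w $ i * L i v) * (x \<bullet> v)\<^sup>2)"
    by (simp add: sum_distrib_left sum_distrib_right mult.assoc) (rule sum.swap)
  also have "\<dots> = 0"
    by (simp add: coord0)
  finally have sum_D: "(\<Sum>i\<in>UNIV. w $ i * D i) = - (\<Sum>i\<in>UNIV. w $ i * (x \<bullet> \<alpha> i)\<^sup>2)"
    by (simp add: D_def right_diff_distrib sum_subtractf)
  have "(\<Sum>i\<in>UNIV. w $ i * D i) \<noteq> 0"
  proof
    assume "(\<Sum>i\<in>UNIV. w $ i * D i) = 0"
    then have "w $ i * D i = 0" for i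
      using D by (simp add: sum_nonneg_eq_0_iff)
    moreover have "w $ i \<noteq> 0" for i
      using sgn_w[of i] eps[of i] by auto
    ultimately have D0: "D i = 0" for i by (metis mult_eq_0_iff)
    obtain i where i: "\<forall>v\<in>V. L i v \<noteq> 0"
      using simplex_support_interior_point[OF indep card supp int w L] by blast
    then obtain c where c: "\<And>v. v \<in> V \<Longrightarrow> x \<bullet> v = c"
      using D_0[OF D0[of i]] by blast
    have const: "x \<bullet> y = c" for y
    proof -
      obtain u where u: "sum u V = 1" "(\<Sum>v\<in>V. u v *\<^sub>R v) = y"
        using barycentric_exists[OF indep, of y] card by (auto simp: barycentric_def)
      have "x \<bullet> y = (\<Sum>v\<in>V. u v * (x \<bullet> v))"
        unfolding u(2)[symmetric] by (simp add: inner_sum_right)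
      also have "\<dots> = c"
        using c u(1) by (simp flip: sum_distrib_right)
      finally show ?thesis .
    qed
    have "x \<bullet> x = x \<bullet> 0" using const by metis
    then show False using \<open>x \<noteq> 0\<close> by simp
  qed
  moreover have "0 \<le> (\<Sum>i\<in>UNIV. w $ i * D i)"
    using D by (intro sum_nonneg) auto
  ultimately show ?thesis using sum_D by linarith
qed

section \<open>Singular points and Hessians of exponential sums\<close>

lemma partial_deriv_exp_sum:
  "partial_deriv j (exp_sum \<alpha> c) = exp_sum \<alpha> (\<chi> i. c $ i * \<alpha> i $ j)"
proof
  fix x
  have "((\<lambda>t. exp_sum \<alpha> c (x + t *\<^sub>R axis j 1))
      has_real_derivative (\<Sum>i\<in>UNIV. c $ i * (exp (\<alpha> i \<bullet> x) * \<alpha> i $ j))) (at 0)"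
    unfolding exp_sum_def
    by (auto intro!: derivative_eq_intros sum.cong simp: inner_add_right inner_axis)
  then show "partial_deriv j (exp_sum \<alpha> c) x = exp_sum \<alpha> (\<chi> i. c $ i * \<alpha> i $ j) x"
    unfolding partial_deriv_def by (simp add: DERIV_imp_deriv exp_sum_def ac_simps)
qed

text \<open>
  The first row of the kernel condition is the value of the function, the other rows are its
  partial derivatives.
\<close>
lemma sing_exp_sum_iff:
  "x \<in> sing (exp_sum \<alpha> c) \<longleftrightarrow> (\<chi> i. c $ i * exp (\<alpha> i \<bullet> x)) \<in> hat_kernel \<alpha>"
  by (simp add: sing_def hat_kernel_iff partial_deriv_exp_sum exp_sum_def vec_eq_iff ac_simps)

lemma rescaled_in_orthant_iff:
  "(\<chi> i. c $ i * exp (g i)) \<in> coeff_orthant \<epsilon> \<longleftrightarrow> c \<in> coeff_orthant \<epsilon>"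
  by (simp add: coeff_orthant_def sgn_mult)

lemma hessian_exp_sum_quadratic_form:
  "v \<bullet> (hessian (exp_sum \<alpha> c) x *v v)
    = (\<Sum>k\<in>UNIV. (c $ k * exp (\<alpha> k \<bullet> x)) * (v \<bullet> \<alpha> k)\<^sup>2)"
proof -
  have "v \<bullet> (hessian (exp_sum \<alpha> c) x *v v)
      = (\<Sum>i\<in>UNIV. \<Sum>j\<in>UNIV. \<Sum>k\<in>UNIV.
          (c $ k * exp (\<alpha> k \<bullet> x)) * ((v $ i * \<alpha> k $ i) * (v $ j * \<alpha> k $ j)))"
    by (simp add: inner_vec_def[of v] matrix_vector_mult_def hessian_def partial_deriv_exp_sum
        exp_sum_def sum_distrib_left sum_distrib_right ac_simps)
  also have "\<dots> = (\<Sum>i\<in>UNIV. \<Sum>k\<in>UNIV. \<Sum>j\<in>UNIV.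
          (c $ k * exp (\<alpha> k \<bullet> x)) * ((v $ i * \<alpha> k $ i) * (v $ j * \<alpha> k $ j)))"
    by (intro sum.cong refl sum.swap)
  also have "\<dots> = (\<Sum>k\<in>UNIV. \<Sum>i\<in>UNIV. \<Sum>j\<in>UNIV.
          (c $ k * exp (\<alpha> k \<bullet> x)) * ((v $ i * \<alpha> k $ i) * (v $ j * \<alpha> k $ j)))"
    by (rule sum.swap)
  also have "\<dots> = (\<Sum>k\<in>UNIV. (c $ k * exp (\<alpha> k \<bullet> x)) * (v \<bullet> \<alpha> k)\<^sup>2)"
    by (simp add: inner_vec_def[of v] power2_eq_square sum_product flip: sum_distrib_left)
  finally show ?thesis .
qed

section \<open>The Horn--Kapranov parametrization\<close>

lemma transpose_mult_vec: "transpose B *v z = (\<Sum>i\<in>UNIV. z $ i *\<^sub>R (B $ i :: real ^ 'd))"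
  by (simp add: vec_eq_iff matrix_vector_mult_def transpose_def mult.commute)

lemma gale_dual_range:
  assumes "gale_dual \<alpha> B"
  shows "range (\<lambda>y. B *v y) = hat_kernel \<alpha>"
proof
  have span: "span (columns B) = hat_kernel \<alpha>"
    using assms by (simp add: gale_dual_def)
  show "range (\<lambda>y. B *v y) \<subseteq> hat_kernel \<alpha>"
    unfolding span[symmetric] using matrix_vector_mult_in_columnspace by blast
  have "column j B \<in> range (\<lambda>y. B *v y)" for j
    by (rule range_eqI[of _ _ "axis j 1"]) (simp add: matrix_vector_mult_basis)
  then have "columns B \<subseteq> range (\<lambda>y. B *v y)"
    unfolding columns_def by blast
  moreover have "subspace (range (\<lambda>y. B *v y))"
    by (intro linear_subspace_image matrix_vector_mul_linear subspace_UNIV)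
  ultimately show "hat_kernel \<alpha> \<subseteq> range (\<lambda>y. B *v y)"
    unfolding span[symmetric] by (rule span_minimal)
qed

lemma gale_dual_mult_eq_0:
  assumes "gale_dual \<alpha> B" "B *v y = 0"
  shows "y = 0"
proof -
  let ?f = "\<lambda>j. column j B"
  have inj: "inj ?f" and indep: "independent (range ?f)"
    using assms(1) by (auto simp: gale_dual_def columns_def full_SetCompr_eq)
  have "(\<Sum>v\<in>range ?f. (y $ inv ?f v) *\<^sub>R v) = (\<Sum>j\<in>UNIV. y $ j *\<^sub>R column j B)"
    using inj by (simp add: sum.reindex inv_f_f[OF inj])
  also have "\<dots> = 0"
    using assms(2) by (simp add: matrix_mult_sum scalar_mult_eq_scaleR)
  finally have "y $ inv ?f (?f j) = 0" for j
    using independentD[OF indep _ order.refl, of "\<lambda>v. y $ inv ?f v" "?f j"] by simp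
  then show ?thesis
    by (simp add: vec_eq_iff inv_f_f[OF inj])
qed

text \<open>
  If \<open>x\<close> is a singular point of the sum with coefficients \<open>c\<close>, then \<open>w = (c\<^sub>i exp (\<alpha>\<^sub>i \<bullet> x))\<^sub>i\<close> lies in
  the kernel and \<open>Log \<bar>w\<bar>\<close> differs from \<open>Log \<bar>c\<bar>\<close> by the vector \<open>(\<alpha>\<^sub>i \<bullet> x)\<^sub>i\<close> of the row space, which \<open>B\<^sup>T\<close>
  kills. So singularities may be moved to the origin, and the kernel is the range of \<open>B\<close>.
\<close>
lemma Horn_Kapranov_parametrization:
  fixes \<alpha> :: "'m::finite \<Rightarrow> real ^ 'n::finite" and B :: "real ^ 'd ^ 'm"
  assumes supp: "signed_support \<alpha> \<epsilon>" and gale: "gale_dual \<alpha> B"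
  shows "signed_reduced_discriminant \<alpha> \<epsilon> B
       = (\<lambda>y. transpose B *v (\<chi> i. ln \<bar>(B *v y) $ i\<bar>)) ` {y. B *v y \<in> coeff_orthant \<epsilon>}"
    (is "_ = ?\<Phi> ` ?C")
proof
  show "signed_reduced_discriminant \<alpha> \<epsilon> B \<subseteq> ?\<Phi> ` ?C"
  proof
    fix z assume "z \<in> signed_reduced_discriminant \<alpha> \<epsilon> B"
    then obtain c x where c: "c \<in> coeff_orthant \<epsilon>" and x: "x \<in> sing (exp_sum \<alpha> c)"
      and z: "z = transpose B *v (\<chi> i. ln \<bar>c $ i\<bar>)"
      by (auto simp: signed_reduced_discriminant_def signed_discriminant_def)
    let ?w = "(\<chi> i. c $ i * exp (\<alpha> i \<bullet> x)) :: real ^ 'm"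
    have "?w \<in> range (\<lambda>y. B *v y)"
      using x by (simp add: gale_dual_range[OF gale] sing_exp_sum_iff)
    then obtain y where y: "?w = B *v y" by blast
    have "y \<in> ?C"
      using c by (simp add: rescaled_in_orthant_iff flip: y)
    have "c $ i \<noteq> 0" for i
    proof -
      have "sgn (c $ i) = \<epsilon> i" "\<epsilon> i = 1 \<or> \<epsilon> i = -1"
        using c supp by (simp_all add: coeff_orthant_def signed_support_def)
      then show ?thesis by auto
    qed
    then have ln: "ln \<bar>?w $ i\<bar> = ln \<bar>c $ i\<bar> + \<alpha> i \<bullet> x" for i
      by (simp add: abs_mult ln_mult)
    have shift: "(\<Sum>i\<in>UNIV. (\<alpha> i \<bullet> x) *\<^sub>R (B $ i)) = 0"
    proof -
      have "(\<Sum>i\<in>UNIV. (\<alpha> i \<bullet> x) * B $ i $ j) = 0" for j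
      proof -
        have "B *v axis j 1 \<in> hat_kernel \<alpha>"
          using gale_dual_range[OF gale] by blast
        from hat_kernel_affine[OF this, of x 0] show ?thesis
          by (simp add: matrix_vector_mult_basis column_def inner_commute mult.commute)
      qed
      then show ?thesis by (simp add: vec_eq_iff)
    qed
    have "?\<Phi> y = z"
      unfolding z transpose_mult_vec
      by (simp add: ln[unfolded y] scaleR_add_left sum.distrib shift)
    with \<open>y \<in> ?C\<close> show "z \<in> ?\<Phi> ` ?C" by blast
  qed
  show "?\<Phi> ` ?C \<subseteq> signed_reduced_discriminant \<alpha> \<epsilon> B"
  proof clarify
    fix y assume y: "B *v y \<in> coeff_orthant \<epsilon>"
    have "B *v y \<in> hat_kernel \<alpha>"
      using gale_dual_range[OF gale] by blast
    then have "0 \<in> sing (exp_sum \<alpha> (B *v y))"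
      by (simp add: sing_exp_sum_iff)
    with y show "?\<Phi> y \<in> signed_reduced_discriminant \<alpha> \<epsilon> B"
      by (auto simp: signed_reduced_discriminant_def signed_discriminant_def)
  qed
qed

section \<open>Complements of strictly turning curves\<close>

lemma components_Un_connected:
  assumes "connected X" "connected Y"
  shows "finite (components (X \<union> Y)) \<and> card (components (X \<union> Y)) \<le> 2"
proof -
  let ?f = "connected_component_set (X \<union> Y)"
  have one: "\<exists>c. ?f ` Z \<subseteq> {c}" if "connected Z" "Z \<subseteq> X \<union> Y" for Z
  proof (cases "Z = {}")
    case False
    then obtain z where "z \<in> Z" by blast
    have "?f z' = ?f z" if "z' \<in> Z" for z'
      using \<open>connected Z\<close> \<open>Z \<subseteq> X \<union> Y\<close> \<open>z \<in> Z\<close> that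
      by (metis connected_component_def connected_component_eq mem_Collect_eq)
    then show ?thesis by blast
  qed auto
  obtain a b where "?f ` X \<subseteq> {a}" "?f ` Y \<subseteq> {b}"
    using one[OF assms(1)] one[OF assms(2)] by blast
  then have sub: "components (X \<union> Y) \<subseteq> {a, b}"
    by (auto simp: components_def)
  have "card (components (X \<union> Y)) \<le> card {a, b}"
    by (rule card_mono[OF _ sub]) simp
  also have "\<dots> \<le> 2" by (simp add: card_insert_if)
  finally show ?thesis
    using finite_subset[OF sub] by simp
qed

text \<open>
  In the plane, with \<open>q\<close> as horizontal coordinate, \<open>p\<close> as height and \<open>d\<close> pointing upwards, the image is
  a graph over an interval which stays above a line, such as the graph of a convex function.
  The points above the graph, \<open>E\<close>, are the continuous image of
  \<open>I \<times> (0, \<infinity>)\<close> and so connected. The rest, \<open>L\<close>, is closed under moving downwards, so each of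
  its points is joined by a vertical ray to the half-space \<open>H\<close> below the graph. If the
  graph stops at a finite height, \<open>L\<close> reaches around its end.
\<close>
lemma complement_of_graph_above_halfspace:
  fixes \<phi> :: "real \<Rightarrow> 'a::real_inner"
  assumes I: "connected I" and cont: "continuous_on I \<phi>"
    and inj: "inj_on (\<lambda>t. \<phi> t \<bullet> q) I" and dq: "d \<bullet> q = 0"
    and dp: "d \<bullet> p > 0" and above: "\<And>t. t \<in> I \<Longrightarrow> m \<le> \<phi> t \<bullet> p"
  shows "finite (components (- \<phi> ` I)) \<and> card (components (- \<phi> ` I)) \<le> 2"
proof -
  define E where "E = (\<lambda>z. \<phi> (fst z) + snd z *\<^sub>R d) ` (I \<times> {0<..})"
  define L where "L = - (\<phi> ` I \<union> E)"
  define H where "H = {z. p \<bullet> z < m}"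
  have E_iff: "z \<in> E \<longleftrightarrow> (\<exists>t\<in>I. \<exists>r>0. z = \<phi> t + r *\<^sub>R d)" for z
    by (force simp: E_def)
  have "connected E"
    unfolding E_def
  proof (rule connected_continuous_image)
    show "connected (I \<times> {0::real<..})"
      using I by (intro connected_Times) auto
    show "continuous_on (I \<times> {0<..}) (\<lambda>z. \<phi> (fst z) + snd z *\<^sub>R d)"
      by (intro continuous_intros continuous_on_compose2[OF cont]) auto
  qed
  have "E \<inter> \<phi> ` I = {}"
  proof -
    have False if "t \<in> I" "t' \<in> I" "r > 0" "\<phi> t + r *\<^sub>R d = \<phi> t'" for t t' r
    proof -
      have "\<phi> t \<bullet> q = \<phi> t' \<bullet> q"
        using arg_cong[OF that(4), of "\<lambda>z. z \<bullet> q"] dq by (simp add: inner_add_left)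
      then have "t = t'" using inj that by (auto dest: inj_onD)
      then have "d = 0" using that by simp
      with dp show False by simp
    qed
    then show ?thesis by (fastforce simp: E_iff)
  qed
  then have split: "- \<phi> ` I = L \<union> E"
    unfolding L_def by blast
  have \<phi>E: "z \<in> \<phi> ` I \<union> E \<longleftrightarrow> (\<exists>t\<in>I. \<exists>r\<ge>0. z = \<phi> t + r *\<^sub>R d)" for z
  proof
    assume "z \<in> \<phi> ` I \<union> E"
    then show "\<exists>t\<in>I. \<exists>r\<ge>0. z = \<phi> t + r *\<^sub>R d"
    proof
      assume "z \<in> \<phi> ` I"
      then obtain t where "t \<in> I" "z = \<phi> t + 0 *\<^sub>R d" by auto
      then show ?thesis by blast
    next
      assume "z \<in> E"
      then show ?thesis unfolding E_iff by (meson less_imp_le)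
    qed
  next
    assume "\<exists>t\<in>I. \<exists>r\<ge>0. z = \<phi> t + r *\<^sub>R d"
    then obtain t r where "t \<in> I" "r \<ge> 0" "z = \<phi> t + r *\<^sub>R d" by blast
    then show "z \<in> \<phi> ` I \<union> E"
      unfolding Un_iff E_iff by (cases "r = 0") (auto simp: less_le)
  qed
  have HL: "H \<subseteq> L"
  proof
    fix z assume "z \<in> H"
    then have z: "z \<bullet> p < m" by (simp add: H_def inner_commute)
    have "m \<le> (\<phi> t + r *\<^sub>R d) \<bullet> p" if "t \<in> I" "r \<ge> 0" for t r
      using above[OF that(1)] that(2) dp by (simp add: inner_add_left add_increasing2)
    with z have "z \<notin> \<phi> ` I \<union> E"
      unfolding \<phi>E by force
    then show "z \<in> L" by (simp add: L_def)
  qed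
  have "connected H"
    unfolding H_def by (intro convex_connected convex_halfspace_lt)
  have "connected L"
  proof -
    define R where "R = (\<lambda>z. (\<lambda>r. z - r *\<^sub>R d) ` {0..})"
    have R_conn: "connected (H \<union> R z)" for z
    proof (rule connected_Un[OF \<open>connected H\<close>])
      show "connected (R z)"
        unfolding R_def by (intro connected_continuous_image continuous_intros) auto
      define r where "r = \<bar>(z \<bullet> p - m) / (d \<bullet> p)\<bar> + 1"
      have "(z \<bullet> p - m) / (d \<bullet> p) < r" "r \<ge> 0"
        unfolding r_def by linarith+
      then have "z \<bullet> p - m < r * (d \<bullet> p)" using dp by (simp add: field_simps)
      then have "z - r *\<^sub>R d \<in> H" by (simp add: H_def inner_diff_right inner_commute)
      with \<open>r \<ge> 0\<close> show "H \<inter> R z \<noteq> {}" by (auto simp: R_def)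
    qed
    have "R z \<subseteq> L" if "z \<in> L" for z
    proof
      fix y assume "y \<in> R z"
      then obtain r where r: "r \<ge> 0" "y = z - r *\<^sub>R d" by (auto simp: R_def)
      show "y \<in> L"
      proof (rule ccontr)
        assume "y \<notin> L"
        then obtain t r' where "t \<in> I" "r' \<ge> 0" "y = \<phi> t + r' *\<^sub>R d"
          using \<phi>E[of y] by (auto simp: L_def)
        then have "t \<in> I" "r' + r \<ge> 0" "z = \<phi> t + (r' + r) *\<^sub>R d"
          using r by (auto simp: algebra_simps)
        then have "z \<in> \<phi> ` I \<union> E"
          unfolding \<phi>E by blast
        with that show False by (simp add: L_def)
      qed
    qed
    moreover have "z \<in> R z" for z
      unfolding R_def by (rule image_eqI[of _ _ 0]) auto
    ultimately have "L = \<Union> (insert H ((\<lambda>z. H \<union> R z) ` L))"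
      using HL by auto
    moreover have "connected (\<Union> (insert H ((\<lambda>z. H \<union> R z) ` L)))"
    proof (rule connected_Union)
      have "((m - 1) / (d \<bullet> p)) *\<^sub>R d \<in> H"
        using dp by (simp add: H_def inner_commute)
      then show "\<Inter> (insert H ((\<lambda>z. H \<union> R z) ` L)) \<noteq> {}" by blast
    qed (use R_conn \<open>connected H\<close> in auto)
    ultimately show ?thesis by simp
  qed
  then show ?thesis
    unfolding split using \<open>connected E\<close> by (rule components_Un_connected)
qed

text \<open>
  Seen in the coordinates \<open>\<phi> \<bullet> q\<close> and \<open>\<phi> \<bullet> p\<close> the curve has slope \<open>- t\<close> at time \<open>t\<close>, so it is the graph of
  a strictly concave or convex function, according to the sign of \<open>s\<close>. This sign is constant. The tangent at
  time \<open>0\<close> is horizontal and bounds the curve on one side; if it does so from above, \<open>p\<close> and \<open>d\<close>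
  are replaced by their negatives.
\<close>
lemma complement_of_turning_curve:
  fixes \<phi> :: "real \<Rightarrow> 'a::real_inner"
  assumes I: "is_interval I" and "0 \<in> I"
    and deriv: "\<And>t. t \<in> I \<Longrightarrow> (\<phi> has_vector_derivative \<phi>' t) (at t)"
    and q: "\<And>t. t \<in> I \<Longrightarrow> \<phi>' t \<bullet> q = s t"
    and p: "\<And>t. t \<in> I \<Longrightarrow> \<phi>' t \<bullet> p = - t * s t"
    and s: "continuous_on I s" "\<And>t. t \<in> I \<Longrightarrow> s t \<noteq> 0"
    and d: "d \<bullet> q = 0" "d \<bullet> p > 0"
  shows "finite (components (- \<phi> ` I)) \<and> card (components (- \<phi> ` I)) \<le> 2"
proof -
  have inner_deriv: "((\<lambda>t. \<phi> t \<bullet> x) has_real_derivative \<phi>' t \<bullet> x) (at t)" if "t \<in> I" for t x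
    using bounded_linear.has_vector_derivative[OF bounded_linear_inner_left deriv[OF that]]
    by (simp add: has_real_derivative_iff_has_vector_derivative)
  have mvt: "\<exists>r\<in>I. a < r \<and> r < b \<and> \<phi> b \<bullet> x - \<phi> a \<bullet> x = (b - a) * (\<phi>' r \<bullet> x)"
    if "a \<in> I" "b \<in> I" "a < b" for a b x
  proof -
    have sub: "r \<in> I" if "a \<le> r" "r \<le> b" for r
      using I \<open>a \<in> I\<close> \<open>b \<in> I\<close> that unfolding is_interval_1 by blast
    obtain r where "a < r" "r < b" "\<phi> b \<bullet> x - \<phi> a \<bullet> x = (b - a) * (\<phi>' r \<bullet> x)"
      using MVT2[OF \<open>a < b\<close> inner_deriv[OF sub]] by blast
    with sub[of r] show ?thesis by auto
  qed
  have conn: "connected I"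
    using I by (simp add: is_interval_connected)
  have cont: "continuous_on I \<phi>"
    using deriv by (meson continuous_at_imp_continuous_on has_vector_derivative_continuous)
  have inj: "inj_on (\<lambda>t. \<phi> t \<bullet> q) I"
  proof (rule linorder_inj_onI)
    fix a b assume "a < b" "a \<in> I" "b \<in> I"
    with mvt[of a b q] q s(2) show "\<phi> a \<bullet> q \<noteq> \<phi> b \<bullet> q" by force
  qed auto
  have increment: "\<exists>r\<in>I. \<exists>k\<ge>0. \<phi> t \<bullet> p - \<phi> 0 \<bullet> p = - k * s r" if "t \<in> I" for t
  proof (cases t "0::real" rule: linorder_cases)
    case less
    with mvt[OF that \<open>0 \<in> I\<close>, of p] obtain r where r: "r \<in> I" "r < 0"
      "\<phi> 0 \<bullet> p - \<phi> t \<bullet> p = (0 - t) * (- r * s r)" using p by auto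
    then show ?thesis
      using less by (intro bexI[of _ r] exI[of _ "t * r"]) (auto simp: mult_nonpos_nonpos)
  next
    case equal
    then show ?thesis using that by (intro bexI[of _ 0] exI[of _ 0]) auto
  next
    case greater
    with mvt[OF \<open>0 \<in> I\<close> that, of p] obtain r where r: "r \<in> I" "r > 0"
      "\<phi> t \<bullet> p - \<phi> 0 \<bullet> p = (t - 0) * (- r * s r)" using p by auto
    then show ?thesis
      using greater by (intro bexI[of _ r] exI[of _ "t * r"]) auto
  qed
  have "(\<forall>t\<in>I. s t < 0) \<or> (\<forall>t\<in>I. s t > 0)"
  proof (rule ccontr)
    assume "\<not> ?thesis"
    then obtain a b where "a \<in> I" "b \<in> I" "s a < 0" "s b > 0"
      using s(2) by (meson linorder_neqE_linordered_idom)
    moreover have "connected (s ` I)"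
      using conn s(1) by (rule connected_continuous_image[rotated])
    ultimately have "0 \<in> s ` I"
      using connected_contains_Icc[of "s ` I" "s a" "s b"] by auto
    with s(2) show False by auto
  qed
  then show ?thesis
  proof
    assume neg: "\<forall>t\<in>I. s t < 0"
    have "\<phi> 0 \<bullet> p \<le> \<phi> t \<bullet> p" if t: "t \<in> I" for t
    proof -
      obtain r k where "r \<in> I" "k \<ge> 0" "\<phi> t \<bullet> p - \<phi> 0 \<bullet> p = - k * s r"
        using increment[OF t] by blast
      then show ?thesis
        using neg mult_nonneg_nonpos[of k "s r"] by fastforce
    qed
    then show ?thesis
      using complement_of_graph_above_halfspace[OF conn cont inj d] by blast
  next
    assume pos: "\<forall>t\<in>I. s t > 0"
    have "\<phi> 0 \<bullet> - p \<le> \<phi> t \<bullet> - p" if t: "t \<in> I" for t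
    proof -
      obtain r k where "r \<in> I" "k \<ge> 0" "\<phi> t \<bullet> p - \<phi> 0 \<bullet> p = - k * s r"
        using increment[OF t] by blast
      then show ?thesis
        using pos mult_nonneg_nonneg[of k "s r"] by fastforce
    qed
    moreover have "- d \<bullet> q = 0" "- d \<bullet> - p > 0" using d by auto
    ultimately show ?thesis
      using complement_of_graph_above_halfspace[OF conn cont inj] by blast
  qed
qed

section \<open>The reduced discriminant in codimension two\<close>

lemma perpendicular_line:
  fixes \<beta> :: "real ^ 2"
  assumes "\<beta> \<noteq> 0"
  shows "\<exists>q. q \<noteq> 0 \<and> \<beta> \<bullet> q = 0 \<and> (\<forall>y. \<beta> \<bullet> y = 0 \<longrightarrow> (\<exists>c. y = c *\<^sub>R q))"
proof -
  define q :: "real ^ 2" where "q = vector [- \<beta> $ 2, \<beta> $ 1]"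
  have q: "q $ 1 = - \<beta> $ 2" "q $ 2 = \<beta> $ 1" by (simp_all add: q_def)
  have nz: "\<beta> $ 1 \<noteq> 0 \<or> \<beta> $ 2 \<noteq> 0"
    using assms by (auto simp: vec_eq_iff forall_2)
  have "\<exists>c. y = c *\<^sub>R q" if "\<beta> \<bullet> y = 0" for y
  proof -
    have y: "\<beta> $ 1 * y $ 1 + \<beta> $ 2 * y $ 2 = 0"
      using that by (simp add: inner_vec_def sum_2)
    show ?thesis
    proof (cases "\<beta> $ 1 = 0")
      case True
      then have "y = (- y $ 1 / \<beta> $ 2) *\<^sub>R q"
        using nz y by (simp add: vec_eq_iff forall_2 q)
      then show ?thesis by blast
    next
      case False
      then have "y = (y $ 2 / \<beta> $ 1) *\<^sub>R q"
        using y by (simp add: vec_eq_iff forall_2 q field_simps)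
      then show ?thesis by blast
    qed
  qed
  moreover have "q \<noteq> 0" "\<beta> \<bullet> q = 0"
    using nz by (auto simp: vec_eq_iff forall_2 q inner_vec_def sum_2)
  ultimately show ?thesis by blast
qed

text \<open>
  Let \<open>b i\<close> be the rows of \<open>B\<close> and \<open>\<Phi>\<close> the parametrization of \<open>\<Gamma>\<close> by the cone \<open>C\<close> of all \<open>y\<close> for which \<open>B *v y\<close>
  has the prescribed signs. Its derivative is the symmetric matrix \<open>M y = \<Sum>i. b\<^sub>i b\<^sub>i\<^sup>T / (b\<^sub>i \<bullet> y)\<close>, and
  \<open>M y\<close> maps \<open>y\<close> to \<open>\<Sum>i. b\<^sub>i = 0\<close>. So \<open>\<Phi>\<close> is constant on rays and it suffices to follow a line
  \<open>y0 + t q\<close> across \<open>C\<close>; along it the velocity \<open>M y q\<close> is perpendicular to \<open>y\<close>, which makes the curve turn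
  as required by \<open>complement_of_turning_curve\<close>, with \<open>s t = q \<bullet> M y q\<close>.

  The nonvanishing of \<open>s\<close> is where the quadratic form enters. If \<open>s t = 0\<close>, then \<open>B q\<close> divided
  entrywise by \<open>w = B y\<close> is orthogonal to the kernel, hence an affine function \<open>x \<bullet> \<alpha>\<^sub>i + c\<close> of the
  exponents. Inserting this, the form of \<open>w\<close> at \<open>x\<close> becomes a combination of
  sums over kernel vectors against affine functions, all of them zero. So \<open>x = 0\<close>, which
  makes \<open>q\<close> a multiple of \<open>y\<close>.
\<close>
lemma reduced_discriminant_complement_components:
  fixes \<alpha> :: "'m::finite \<Rightarrow> real ^ 'n::finite" and B :: "real ^ 2 ^ 'm"
  assumes supp: "signed_support \<alpha> \<epsilon>" and gale: "gale_dual \<alpha> B"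
    and anisotropic: "\<And>w x. w \<in> hat_kernel \<alpha> \<Longrightarrow> w \<in> coeff_orthant \<epsilon> \<Longrightarrow> x \<noteq> 0 \<Longrightarrow>
        (\<Sum>i\<in>UNIV. w $ i * (x \<bullet> \<alpha> i)\<^sup>2) \<noteq> 0"
  defines "\<Gamma> \<equiv> signed_reduced_discriminant \<alpha> \<epsilon> B"
  shows "finite (components (- \<Gamma>)) \<and> card (components (- \<Gamma>)) \<le> 2"
proof -
  define b where "b = (\<lambda>i. B $ i)"
  define C where "C = {y. B *v y \<in> coeff_orthant \<epsilon>}"
  define \<Phi> where "\<Phi> = (\<lambda>y. \<Sum>i\<in>UNIV. ln (\<epsilon> i * (b i \<bullet> y)) *\<^sub>R b i)"
  have eps: "\<epsilon> i = 1 \<or> \<epsilon> i = -1" for i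
    using supp by (simp add: signed_support_def)
  have By: "(B *v y) $ i = b i \<bullet> y" for y i
    by (simp add: b_def matrix_vector_mul_component)
  have C_iff: "y \<in> C \<longleftrightarrow> (\<forall>i. 0 < \<epsilon> i * (b i \<bullet> y))" for y
  proof -
    have "sgn (b i \<bullet> y) = \<epsilon> i \<longleftrightarrow> 0 < \<epsilon> i * (b i \<bullet> y)" for i
      using eps[of i] by (auto simp: sgn_1_pos sgn_1_neg)
    then show ?thesis by (simp add: C_def coeff_orthant_def By)
  qed
  have B_ker: "B *v y \<in> hat_kernel \<alpha>" for y
    using gale_dual_range[OF gale] by blast
  have b_sum: "(\<Sum>i\<in>UNIV. b i \<bullet> y) = 0" for y
    using B_ker[of y] by (simp add: hat_kernel_iff By)
  then have "(\<Sum>i\<in>UNIV. b i) \<bullet> y = 0" for y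
    by (simp add: inner_sum_left)
  then have b_sum0: "(\<Sum>i\<in>UNIV. b i) = 0"
    using inner_eq_zero_iff by blast
  have "\<Gamma> = (\<lambda>y. transpose B *v (\<chi> i. ln \<bar>(B *v y) $ i\<bar>)) ` C"
    unfolding \<Gamma>_def C_def by (rule Horn_Kapranov_parametrization[OF supp gale])
  also have "\<dots> = \<Phi> ` C"
  proof (rule image_cong[OF refl])
    fix y assume "y \<in> C"
    have "\<bar>b i \<bullet> y\<bar> = \<epsilon> i * (b i \<bullet> y)" for i
    proof -
      have "0 < \<epsilon> i * (b i \<bullet> y)" using \<open>y \<in> C\<close> C_iff by blast
      then show ?thesis using eps[of i] by auto
    qed
    then show "transpose B *v (\<chi> i. ln \<bar>(B *v y) $ i\<bar>) = \<Phi> y"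
      unfolding transpose_mult_vec \<Phi>_def By by (simp add: b_def)
  qed
  finally have \<Gamma>_eq: "\<Gamma> = \<Phi> ` C" .
  show ?thesis
  proof (cases "C = {}")
    case True
    then show ?thesis
      using components_Un_connected[of UNIV "{} :: (real ^ 2) set"] by (simp add: \<Gamma>_eq)
  next
    case False
    then obtain y0 where y0: "y0 \<in> C" by blast
    \<comment> \<open>Any row serves: the line \<open>\<beta> \<bullet> y = \<beta> \<bullet> y0\<close> meets every ray of \<open>C\<close> since \<open>\<beta>\<close> is positive on \<open>C\<close>.\<close>
    fix i0 :: 'm
    define \<beta> where "\<beta> = \<epsilon> i0 *\<^sub>R b i0"
    have \<beta>: "\<beta> \<bullet> y > 0" if "y \<in> C" for y
      using that by (simp add: \<beta>_def C_iff)
    then have "\<beta> \<noteq> 0" using y0 by force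
    then obtain q where q: "q \<noteq> 0" "\<beta> \<bullet> q = 0" "\<And>y. \<beta> \<bullet> y = 0 \<Longrightarrow> \<exists>c. y = c *\<^sub>R q"
      using perpendicular_line by blast
    define y where "y = (\<lambda>t. y0 + t *\<^sub>R q)"
    define I where "I = {t. y t \<in> C}"
    define s where "s = (\<lambda>t. \<Sum>i\<in>UNIV. (b i \<bullet> q)\<^sup>2 / (b i \<bullet> y t))"
    define \<phi>' where "\<phi>' = (\<lambda>t. \<Sum>i\<in>UNIV. ((b i \<bullet> q) / (b i \<bullet> y t)) *\<^sub>R b i)"
    have nz: "b i \<bullet> y t \<noteq> 0" if "t \<in> I" for t i
      using that by (auto simp: I_def C_iff dest: spec[of _ i])
    have interval: "is_interval I"
      unfolding is_interval_1
    proof (intro ballI allI impI)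
      fix l u t assume lu: "l \<in> I" "u \<in> I" "l \<le> t \<and> t \<le> u"
      have "0 < \<epsilon> i * (b i \<bullet> y t)" for i
      proof -
        have aff: "\<epsilon> i * (b i \<bullet> y r) = \<epsilon> i * (b i \<bullet> y0) + r * (\<epsilon> i * (b i \<bullet> q))" for r
          by (simp add: y_def inner_add_right algebra_simps)
        have "0 < \<epsilon> i * (b i \<bullet> y l)" "0 < \<epsilon> i * (b i \<bullet> y u)"
          using lu by (auto simp: I_def C_iff)
        moreover have "l * c \<le> t * c \<or> u * c \<le> t * c" for c :: real
          using lu(3) by (metis linear mult_right_mono mult_right_mono_neg)
        ultimately show ?thesis
          unfolding aff by (smt (verit))
      qed
      then show "t \<in> I" by (simp add: I_def C_iff)
    qed
    have "0 \<in> I" using y0 by (simp add: I_def y_def)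
    have \<Gamma>_arc: "\<Gamma> = (\<lambda>t. \<Phi> (y t)) ` I"
    proof -
      have "\<Phi> z \<in> (\<lambda>t. \<Phi> (y t)) ` I" if z: "z \<in> C" for z
      proof -
        define r where "r = (\<beta> \<bullet> y0) / (\<beta> \<bullet> z)"
        have "r > 0" using \<beta> y0 z by (simp add: r_def)
        have "\<beta> \<bullet> (r *\<^sub>R z - y0) = 0"
          using \<beta>[OF z] by (simp add: r_def inner_diff_right)
        then obtain t where t: "r *\<^sub>R z = y t"
          using q(3) by (metis add.commute diff_add_cancel y_def)
        have "t \<in> I"
          using z \<open>r > 0\<close> by (simp add: I_def C_iff mult.left_commute flip: t)
        have "\<Phi> (r *\<^sub>R z) = (\<Sum>i\<in>UNIV. ln r *\<^sub>R b i + ln (\<epsilon> i * (b i \<bullet> z)) *\<^sub>R b i)"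
          unfolding \<Phi>_def
        proof (intro sum.cong refl)
          fix i
          have "0 < \<epsilon> i * (b i \<bullet> z)" using z C_iff by blast
          then have "ln (r * (\<epsilon> i * (b i \<bullet> z))) = ln r + ln (\<epsilon> i * (b i \<bullet> z))"
            using \<open>r > 0\<close> by (intro ln_mult_pos) auto
          then show "ln (\<epsilon> i * (b i \<bullet> r *\<^sub>R z)) *\<^sub>R b i
              = ln r *\<^sub>R b i + ln (\<epsilon> i * (b i \<bullet> z)) *\<^sub>R b i"
            by (simp add: mult.left_commute scaleR_add_left)
        qed
        also have "\<dots> = \<Phi> z"
          by (simp add: sum.distrib \<Phi>_def b_sum0 flip: scaleR_sum_right)
        finally show ?thesis using t \<open>t \<in> I\<close> by force
      qed
      then show ?thesis by (auto simp: \<Gamma>_eq I_def)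
    qed
    have "((\<lambda>t. \<Phi> (y t)) has_vector_derivative \<phi>' t) (at t)" if t: "t \<in> I" for t
      unfolding \<Phi>_def \<phi>'_def
    proof (rule has_vector_derivative_sum)
      fix i
      have pos: "0 < \<epsilon> i * (b i \<bullet> y t)" using t by (simp add: I_def C_iff)
      have "((\<lambda>t. ln (\<epsilon> i * (b i \<bullet> y t))) has_real_derivative
          (\<epsilon> i * (b i \<bullet> q)) / (\<epsilon> i * (b i \<bullet> y t))) (at t)"
        using pos unfolding y_def
        by (auto intro!: derivative_eq_intros simp: inner_add_right)
      moreover have "(\<epsilon> i * (b i \<bullet> q)) / (\<epsilon> i * (b i \<bullet> y t)) = (b i \<bullet> q) / (b i \<bullet> y t)"
        using eps[of i] by auto
      ultimately have "((\<lambda>t. ln (\<epsilon> i * (b i \<bullet> y t))) has_vector_derivative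
          (b i \<bullet> q) / (b i \<bullet> y t)) (at t)"
        by (simp add: has_real_derivative_iff_has_vector_derivative)
      then show "((\<lambda>t. ln (\<epsilon> i * (b i \<bullet> y t)) *\<^sub>R b i) has_vector_derivative
          ((b i \<bullet> q) / (b i \<bullet> y t)) *\<^sub>R b i) (at t)"
        by (rule bounded_linear.has_vector_derivative[OF bounded_linear_scaleR_left])
    qed
    moreover have "\<phi>' t \<bullet> q = s t" for t
      by (simp add: \<phi>'_def s_def inner_sum_left power2_eq_square)
    \<comment> \<open>Here \<open>y0 = y t - t q\<close>, and the velocity is perpendicular to \<open>y t\<close>.\<close>
    moreover have "\<phi>' t \<bullet> y0 = - t * s t" if t: "t \<in> I" for t
    proof -
      have "\<phi>' t \<bullet> y0 = (\<Sum>i\<in>UNIV. (b i \<bullet> q) - t * ((b i \<bullet> q)\<^sup>2 / (b i \<bullet> y t)))"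
        unfolding \<phi>'_def inner_sum_left
      proof (intro sum.cong refl)
        fix i
        have y0_eq: "b i \<bullet> y0 = b i \<bullet> y t - t * (b i \<bullet> q)"
          by (simp add: y_def inner_add_right)
        show "((b i \<bullet> q) / (b i \<bullet> y t)) *\<^sub>R b i \<bullet> y0
            = (b i \<bullet> q) - t * ((b i \<bullet> q)\<^sup>2 / (b i \<bullet> y t))"
          unfolding inner_scaleR_left y0_eq
          using nz[OF t, of i] by (simp add: field_simps power2_eq_square)
      qed
      also have "\<dots> = - t * s t"
        by (simp add: sum_subtractf b_sum s_def sum_distrib_left sum_negf)
      finally show ?thesis .
    qed
    moreover have "continuous_on I s"
      unfolding s_def y_def by (intro continuous_intros) (use nz in \<open>auto simp: y_def\<close>)
    moreover have "s t \<noteq> 0" if t: "t \<in> I" for t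
    proof
      assume s0: "s t = 0"
      have yC: "y t \<in> C" using t by (simp add: I_def)
      define z :: "real ^ 'm" where "z = (\<chi> i. (b i \<bullet> q) / (b i \<bullet> y t))"
      have z_mult: "(B *v y t) $ i * z $ i = b i \<bullet> q" for i
        using nz[OF t, of i] by (simp add: z_def By)
      have "(B *v x) \<bullet> z = 0" for x
      proof -
        define a where "a = (\<beta> \<bullet> x) / (\<beta> \<bullet> y t)"
        have "\<beta> \<bullet> (x - a *\<^sub>R y t) = 0"
          using \<beta>[OF yC] by (simp add: a_def inner_diff_right)
        then obtain c where "x - a *\<^sub>R y t = c *\<^sub>R q"
          using q(3) by blast
        then have x: "x = a *\<^sub>R y t + c *\<^sub>R q" by (simp add: algebra_simps)
        have "(B *v x) \<bullet> z = (\<Sum>i\<in>UNIV. a * (b i \<bullet> q) + c * ((b i \<bullet> q)\<^sup>2 / (b i \<bullet> y t)))"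
          unfolding inner_vec_def[of "B *v x" z] By
        proof (intro sum.cong refl)
          fix i
          have split: "(b i \<bullet> x) \<bullet> z $ i = a * ((B *v y t) $ i * z $ i) + c * ((b i \<bullet> q) * z $ i)"
            unfolding x By by (simp add: inner_add_right algebra_simps)
          show "(b i \<bullet> x) \<bullet> z $ i = a * (b i \<bullet> q) + c * ((b i \<bullet> q)\<^sup>2 / (b i \<bullet> y t))"
            unfolding split z_mult by (simp add: z_def power2_eq_square)
        qed
        also have "\<dots> = a * (\<Sum>i\<in>UNIV. b i \<bullet> q) + c * s t"
          by (simp add: sum.distrib s_def sum_distrib_left)
        finally show ?thesis by (simp add: b_sum s0)
      qed
      then have "\<And>v. v \<in> hat_kernel \<alpha> \<Longrightarrow> v \<bullet> z = 0"
        unfolding gale_dual_range[OF gale, symmetric] by auto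
      then obtain c x where z: "\<And>i. z $ i = x \<bullet> \<alpha> i + c"
        using annihilator_hat_kernel by blast
      have "(\<Sum>i\<in>UNIV. (B *v y t) $ i * (x \<bullet> \<alpha> i)\<^sup>2)
          = (\<Sum>i\<in>UNIV. (B *v q) $ i * (x \<bullet> \<alpha> i) - c * ((B *v y t) $ i * (x \<bullet> \<alpha> i)))"
      proof (intro sum.cong refl)
        fix i
        have "(B *v y t) $ i * (x \<bullet> \<alpha> i)\<^sup>2
            = ((B *v y t) $ i * z $ i) * (x \<bullet> \<alpha> i) - c * ((B *v y t) $ i * (x \<bullet> \<alpha> i))"
          by (simp add: z power2_eq_square algebra_simps)
        then show "(B *v y t) $ i * (x \<bullet> \<alpha> i)\<^sup>2
            = (B *v q) $ i * (x \<bullet> \<alpha> i) - c * ((B *v y t) $ i * (x \<bullet> \<alpha> i))"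
          unfolding z_mult By[of q] .
      qed
      also have "\<dots> = 0"
        using hat_kernel_affine[OF B_ker[of q], of x 0] hat_kernel_affine[OF B_ker[of "y t"], of x 0]
        by (simp add: sum_subtractf flip: sum_distrib_left)
      finally have "x = 0"
        using anisotropic[OF B_ker[of "y t"]] yC unfolding C_def by blast
      then have "b i \<bullet> q = c * (b i \<bullet> y t)" for i
        using z_mult[of i] by (simp add: z By mult.commute)
      then have "B *v (q - c *\<^sub>R y t) = 0"
        by (simp add: vec_eq_iff By inner_diff_right)
      then have "q - c *\<^sub>R y t = 0"
        by (rule gale_dual_mult_eq_0[OF gale])
      then have "q = c *\<^sub>R y t" by simp
      with q(1,2) \<beta>[OF yC] show False by auto
    qed
    moreover have "\<beta> \<bullet> q = 0" "\<beta> \<bullet> y0 > 0"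
      using q(2) \<beta>[OF y0] by auto
    ultimately show ?thesis
      unfolding \<Gamma>_arc using complement_of_turning_curve[OF interval \<open>0 \<in> I\<close>] by blast
  qed
qed

theorem theorem4p13:
  fixes V P :: "(real ^ 'n) set"
    and \<alpha> :: "'m::finite \<Rightarrow> real ^ 'n"
    and \<epsilon> :: "'m \<Rightarrow> real"
    and B :: "real ^ 2 ^ 'm"
  assumes "\<not> affine_dependent V" and "card V = CARD('n) + 1" and "P = convex hull V"
    and "signed_support \<alpha> \<epsilon>"
    and "pos_support \<alpha> \<epsilon> \<subseteq> P"
    and "neg_support \<alpha> \<epsilon> \<subseteq> neg_vertex_cones V"
    and "range \<alpha> \<inter> interior (P \<union> neg_vertex_cones V) \<noteq> {}"
  shows "(\<forall>c \<in> coeff_orthant \<epsilon>. \<forall>x \<in> sing (exp_sum \<alpha> c). \<forall>l.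
            eigenvalue (hessian (exp_sum \<alpha> c) x) l \<longrightarrow> l < 0)
       \<and> (codimension \<alpha> = 2 \<and> gale_dual \<alpha> B \<longrightarrow>
            finite (components (- signed_reduced_discriminant \<alpha> \<epsilon> B)) \<and>
            card (components (- signed_reduced_discriminant \<alpha> \<epsilon> B)) \<le> 2)"
proof (intro conjI ballI allI impI)
  have negative: "(\<Sum>i\<in>UNIV. w $ i * (x \<bullet> \<alpha> i)\<^sup>2) < 0"
    if "w \<in> hat_kernel \<alpha>" "w \<in> coeff_orthant \<epsilon>" "x \<noteq> 0" for w x
    using kernel_form_negative_definite[OF assms(1,2,4)] assms(5-7) that
    unfolding assms(3) by blast
  {
    fix c x l
    assume c: "c \<in> coeff_orthant \<epsilon>" and x: "x \<in> sing (exp_sum \<alpha> c)"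
      and "eigenvalue (hessian (exp_sum \<alpha> c) x) l"
    then obtain v where v: "v \<noteq> 0" "hessian (exp_sum \<alpha> c) x *v v = l *\<^sub>R v"
      by (auto simp: eigenvalue_def)
    have "l * (v \<bullet> v) = v \<bullet> (hessian (exp_sum \<alpha> c) x *v v)"
      by (simp add: v(2))
    also have "\<dots> < 0"
      using negative[of "\<chi> i. c $ i * exp (\<alpha> i \<bullet> x)" v] c x v(1)
      by (simp add: hessian_exp_sum_quadratic_form rescaled_in_orthant_iff sing_exp_sum_iff)
    finally have "l * (v \<bullet> v) < 0" .
    moreover have "v \<bullet> v > 0" using v(1) by simp
    ultimately show "l < 0" by (simp add: mult_less_0_iff)
  }
  assume "codimension \<alpha> = 2 \<and> gale_dual \<alpha> B"
  then have gale: "gale_dual \<alpha> B" by simp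
  have anisotropic: "(\<Sum>i\<in>UNIV. w $ i * (x \<bullet> \<alpha> i)\<^sup>2) \<noteq> 0"
    if "w \<in> hat_kernel \<alpha>" "w \<in> coeff_orthant \<epsilon>" "x \<noteq> 0" for w x
    using negative[OF that] by simp
  have two: "finite (components (- signed_reduced_discriminant \<alpha> \<epsilon> B))
      \<and> card (components (- signed_reduced_discriminant \<alpha> \<epsilon> B)) \<le> 2"
    by (rule reduced_discriminant_complement_components[OF assms(4) gale anisotropic])
  show "finite (components (- signed_reduced_discriminant \<alpha> \<epsilon> B))"
    and "card (components (- signed_reduced_discriminant \<alpha> \<epsilon> B)) \<le> 2"
    using two by simp_all
qed

end
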